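(* Let $(S_t)_{t\in\mathbb{N}}$, $S_t=\sigma_t(M_t)$, be an information state (with values in $\mathcal{S}$ and cost distribution $\rho$), let $\mathcal{T}$ be the operator $$[\mathcal{T}\Lambda](s,z)=\inf_{u\in\mathcal{U}}\ \sup_{c\in\mathcal{C},\,s'\in\mathcal{S}}\Big(c+\gamma\,\Lambda(s',\gamma z)+\frac{\rho(c,s'\,|\,s,u)}{z}\Big),\qquad s\in\mathcal{S},\ z\in(0,1],$$ let $\Lambda^n=\mathcal{T}^n\Lambda^0$ with $\Lambda^0\equiv0$, and let $\Lambda^\infty=\lim_{n\to\infty}\Lambda^n$ be the unique uniformly bounded fixed point of $\mathcal{T}$. Suppose the infimum over $u$ in $[\mathcal{T}\Lambda](s,z)$ is achieved for all $(s,z)\in\mathcal{S}\times(0,1]$ when $\Lambda=\Lambda^n$, $n\in\mathbb{N}$, and when $\Lambda=\Lambda^\infty$. Let $\pi^*:\mathcal{S}\times(0,1]\to\mathcal{U}$ satisfy $$\pi^*(s,z)\in\arg\min_{u\in\mathcal{U}}\ \sup_{c\in\mathcal{C},s'\in\mathcal{S}}\Big(c+\gamma\Lambda^\infty(s',\gamma z)+\frac{\rho(c,s'|s,u)}{z}\Big),$$ and let $\boldsymbol g^*=(g_0^*,g_1^*,\dots)$ with $g_t^*(m_t)=\pi^*(\sigma_t(m_t),\gamma^t)$ for all $m_t$ and $t$. Then $\boldsymbol g^*$ achieves the optimal value, i.e. $V_0^{\boldsymbol g^*}(y_0)=V_0(y_0)$ for every feasible $y_0$, and thus $\boldsymbol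 g^*$ attains $\inf_{\boldsymbol g\in\mathcal{G}}\mathcal{J}(\boldsymbol g)$.
   Context: Setting. $\mathbb{N}=\{0,1,2,\dots\}$, $\gamma\in(0,1)$. The nonempty sets $\mathcal{U},\mathcal{W},\mathcal{Y}$ are bounded subsets of a metric space $(E,\eta)$, and $\mathcal{C}\subset\mathbb{R}_{\ge0}$ is bounded with minimum $c^{\min}$ and maximum $c^{\max}$. An uncertain variable is a map $X:\Omega\to\mathcal{X}$ on a fixed sample space $\Omega$; its range is $[[X]]=\{X(\omega):\omega\in\Omega\}$, joint ranges are ranges of tuples, and the conditional range is $[[X|y]]=\{X(\omega): Y(\omega)=y,\ \omega\in\Omega\}$. Disturbances $W_t\in\mathcal{W}$, $t\in\mathbb{N}$, are independent uncertain variables (joint ranges are products of the individual ranges). The system is given by functions $h_0,h_{t+1},d_t$: with actions $U_t\in\mathcal{U}$, the observations are $Y_0=h_0(W_0)$, $Y_{t+1}=h_{t+1}(W_{0:t},U_{0:t})\in\mathcal{Y}$ and the costs are $C_t=d_t(W_{0:t},U_{0:t})\in\mathcal{C}$. The memory is $M_t=(Y_{0:t},U_{0:t-1})$ (so $M_0=Y_0$), with values in $\mathcal{M}_t$ (the product of copies of $\mathcal{Y}$ and $\mathcal{U}$). A strategy is $\boldsymbol g=(g_0,g_1,\dots)$ with arbitrary $g_t:\mathcal{M}_t\to\mathcal{U}$ and $U_t=g_t(M_t)$; $\mathcal{G}$ is the set of strategies. The worst-case discounted cost is $\mathcal{J}(\boldsymbol g)=\lim_{T\to\infty}\sup_{c_{0:T}\in[[C_{0:T}]]^{\boldsymbol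 g}}\sum_{t=0}^T\gamma^tc_t$, where $[[C_{0:T}]]^{\boldsymbol g}$ is the range of $C_{0:T}$ under $\boldsymbol g$. A memory realization $m_t=(y_{0:t},u_{0:t-1})$ is feasible if some disturbance realization produces observations $y_{0:t}$ under actions $u_{0:t-1}$. Ranges conditioned on $m_t$ (or on $(m_t,u_t)$) are taken over all $\omega\in\Omega$ whose disturbances produce $y_{0:t}$ under $u_{0:t-1}$, the past actions being $u_{0:t-1}$ (and the action at $t$ being $u_t$). A superscript $\boldsymbol g$ means that in addition all actions from time $t$ on are generated by $\boldsymbol g$. The accrued cost is $A_t=\sum_{\ell=0}^{t-1}\gamma^\ell C_\ell$ ($A_0=0$), $A_t\in\mathcal{A}=[0,a^{\max}]$, $a^{\max}=c^{\max}/(1-\gamma)$; the cost-to-go is $C_t^\infty=\sum_{\ell=t}^\infty\gamma^{\ell-t}C_\ell$. Value functions: $V_t^{\boldsymbol g}(m_t)=\sup_{(a_t,c_t^\infty)\in[[A_t,C_t^\infty|m_t]]^{\boldsymbol g}}(a_t+\gamma^tc_t^\infty)$ and $V_t(m_t)=\inf_{\boldsymbol g\in\mathcal{G}}V_t^{\boldsymbol g}(m_t)$. Indicator: $\mathbb{I}(x|y)=0$ if $x\in[[X|y]]$ and $-\infty$ otherwise. Conditional accrued distribution: $r_t(x|y)=\sup_{a_t\in\mathcal{A}}(a_t+\mathbb{I}(x,a_t|y))-\sup_{a_t\in\mathcal{A}}(a_t+\mathbb{I}(a_t|y))$. Information state: uncertain variables $S_t=\sigma_t(M_t)$, $t\in\mathbb{N}$,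 with values in a bounded time-invariant subset $\mathcal{S}$ of a metric space, such that there is a time-invariant cost distribution $\rho:\mathcal{C}\times\mathcal{S}\times\mathcal{S}\times\mathcal{U}\to\{-\infty\}\cup[-a^{\max},0]$, written $\rho(c,s'|s,u)$ (being a cost distribution means $\sup_{c\in\mathcal{C},s'\in\mathcal{S}}\rho(c,s'|s,u)=0$ for all $s\in\mathcal{S},u\in\mathcal{U}$), with $r_t(c_t,s_{t+1}|m_t,u_t)=\rho(c_t,s_{t+1}|\sigma_t(m_t),u_t)$ for all $t\in\mathbb{N}$, all feasible $m_t$, all $u_t\in\mathcal{U}$, $c_t\in\mathcal{C}$, $s_{t+1}\in\mathcal{S}$; here $s_{t+1}$ is the argument for $S_{t+1}=\sigma_{t+1}(M_{t+1})$. The operator $\mathcal{T}$ acts on uniformly bounded functions $\Lambda:\mathcal{S}\times(0,1]\to\mathbb{R}$ and is a sup-norm contraction, so the fixed point $\Lambda^\infty$ exists and is unique. *)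

theory Defs
  imports "HOL-Analysis.Analysis" "HOL-Library.NList"
begin

text \<open>
  Finite tuples are lists: a tuple \<open>x\<^sub>0\<^sub>:\<^sub>t\<close> is a list of length \<open>Suc t\<close>.
  A memory realization \<open>(y\<^sub>0\<^sub>:\<^sub>t, u\<^sub>0\<^sub>:\<^sub>t\<^sub>-\<^sub>1)\<close> is a pair of lists of lengths \<open>Suc t\<close> and \<open>t\<close>.
\<close>

type_synonym 'e memory = "'e list \<times> 'e list"
type_synonym 'e strategy = "nat \<Rightarrow> 'e memory \<Rightarrow> 'e"

record ('o, 'e) system =
  Samples :: "'o set"
  Actions :: "'e set"
  Disturbances :: "'e set"
  Observations :: "'e set"
  Costs :: "real set"
  discount :: real
  disturbance :: "nat \<Rightarrow> 'o \<Rightarrow> 'e"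
  obs_init :: "'e \<Rightarrow> 'e"
  obs_fun :: "nat \<Rightarrow> 'e list \<Rightarrow> 'e list \<Rightarrow> 'e"
    \<comment> \<open>\<open>obs_fun P (Suc t)\<close> is \<open>h\<^sub>t\<^sub>+\<^sub>1\<close>; the index 0 is not used (\<open>h\<^sub>0\<close> is \<open>obs_init P\<close>)\<close>
  cost_fun :: "nat \<Rightarrow> 'e list \<Rightarrow> 'e list \<Rightarrow> real"

definition disturbances_upto :: "('o, 'e) system \<Rightarrow> nat \<Rightarrow> 'o \<Rightarrow> 'e list" where
  "disturbances_upto P t \<omega> = map (\<lambda>i. disturbance P i \<omega>) [0..<Suc t]"

text \<open>Independence: the range of each tuple \<open>W\<^sub>0\<^sub>:\<^sub>t\<close> is the product of the individual ranges.\<close>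

definition well_posed :: "('o, 'e::metric_space) system \<Rightarrow> bool" where
  "well_posed P \<longleftrightarrow>
     0 < discount P \<and> discount P < 1 \<and>
     Actions P \<noteq> {} \<and> bounded (Actions P) \<and>
     Disturbances P \<noteq> {} \<and> bounded (Disturbances P) \<and>
     Observations P \<noteq> {} \<and> bounded (Observations P) \<and>
     Costs P \<subseteq> {0..} \<and> bounded (Costs P) \<and>
     (\<exists>m\<in>Costs P. \<forall>c\<in>Costs P. m \<le> c) \<and> (\<exists>m\<in>Costs P. \<forall>c\<in>Costs P. c \<le> m) \<and>
     (\<forall>t. \<forall>\<omega>\<in>Samples P. disturbance P t \<omega> \<in> Disturbances P) \<and>
     (\<forall>t. disturbances_upto P t ` Samples P =
            listset (map (\<lambda>i. disturbance P i ` Samples P) [0..<Suc t])) \<and>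
     (\<forall>w\<in>Disturbances P. obs_init P w \<in> Observations P) \<and>
     (\<forall>t. \<forall>ws\<in>nlists (Suc t) (Disturbances P). \<forall>us\<in>nlists (Suc t) (Actions P).
        obs_fun P (Suc t) ws us \<in> Observations P \<and> cost_fun P t ws us \<in> Costs P)"

definition c_max :: "('o, 'e) system \<Rightarrow> real" where
  "c_max P = Sup (Costs P)"

definition a_max :: "('o, 'e) system \<Rightarrow> real" where
  "a_max P = c_max P / (1 - discount P)"

definition memory_space :: "('o, 'e) system \<Rightarrow> nat \<Rightarrow> 'e memory set" where
  "memory_space P t = nlists (Suc t) (Observations P) \<times> nlists t (Actions P)"

definition strategies :: "('o, 'e) system \<Rightarrow> 'e strategy set" where
  "strategies P = {g. \<forall>t. \<forall>m\<in>memory_space P t. g t m \<in> Actions P}"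


subsection \<open>Trajectories\<close>

text \<open>
  \<open>Y\<^sub>k\<close> and \<open>C\<^sub>k\<close> on the sample \<open>\<omega>\<close> under an action list \<open>us\<close>. They depend on
  \<open>u\<^sub>0\<^sub>:\<^sub>k\<^sub>-\<^sub>1\<close> and \<open>u\<^sub>0\<^sub>:\<^sub>k\<close> only, so \<open>us\<close> must have length at least \<open>k\<close> and \<open>Suc k\<close>, respectively.
\<close>

fun observation :: "('o, 'e) system \<Rightarrow> 'e list \<Rightarrow> 'o \<Rightarrow> nat \<Rightarrow> 'e" where
  "observation P us \<omega> 0 = obs_init P (disturbance P 0 \<omega>)"
| "observation P us \<omega> (Suc k) =
     obs_fun P (Suc k) (disturbances_upto P k \<omega>) (take (Suc k) us)"

definition cost :: "('o, 'e) system \<Rightarrow> 'e list \<Rightarrow> 'o \<Rightarrow> nat \<Rightarrow> real" where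
  "cost P us \<omega> k = cost_fun P k (disturbances_upto P k \<omega>) (take (Suc k) us)"

definition accrued_cost :: "('o, 'e) system \<Rightarrow> 'e list \<Rightarrow> 'o \<Rightarrow> nat \<Rightarrow> real" where
  "accrued_cost P us \<omega> t = (\<Sum>l<t. discount P ^ l * cost P us \<omega> l)"

text \<open>The memory \<open>M\<^sub>t\<close> after the \<open>t = length us\<close> actions \<open>us\<close>.\<close>

definition memory :: "('o, 'e) system \<Rightarrow> 'e list \<Rightarrow> 'o \<Rightarrow> 'e memory" where
  "memory P us \<omega> = (map (observation P us \<omega>) [0..<Suc (length us)], us)"

text \<open>The past actions \<open>us\<close> followed by \<open>n\<close> actions generated by \<open>g\<close>.\<close>

primrec actions :: "('o, 'e) system \<Rightarrow> 'e strategy \<Rightarrow> 'e list \<Rightarrow> 'o \<Rightarrow> nat \<Rightarrow> 'e list" where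
  "actions P g us \<omega> 0 = us"
| "actions P g us \<omega> (Suc n) =
     (let us' = actions P g us \<omega> n in us' @ [g (length us') (memory P us' \<omega>)])"

text \<open>
  \<open>C\<^sub>k\<close> when the actions are \<open>us\<close> up to time \<open>length us\<close> and generated by \<open>g\<close> from then on;
  \<open>Suc k\<close> further actions are enough, since \<open>C\<^sub>k\<close> only depends on \<open>u\<^sub>0\<^sub>:\<^sub>k\<close>.
\<close>

definition cost_under :: "('o, 'e) system \<Rightarrow> 'e strategy \<Rightarrow> 'e list \<Rightarrow> 'o \<Rightarrow> nat \<Rightarrow> real" where
  "cost_under P g us \<omega> k = cost P (actions P g us \<omega> (Suc k)) \<omega> k"

definition cost_to_go :: "('o, 'e) system \<Rightarrow> 'e strategy \<Rightarrow> 'e list \<Rightarrow> 'o \<Rightarrow> nat \<Rightarrow> real" where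
  "cost_to_go P g us \<omega> t = (\<Sum>l. discount P ^ l * cost_under P g us \<omega> (t + l))"


subsection \<open>Performance and value functions\<close>

definition cost_range :: "('o, 'e) system \<Rightarrow> 'e strategy \<Rightarrow> nat \<Rightarrow> real list set" where
  "cost_range P g T = (\<lambda>\<omega>. map (cost_under P g [] \<omega>) [0..<Suc T]) ` Samples P"

definition worst_case_cost :: "('o, 'e) system \<Rightarrow> 'e strategy \<Rightarrow> ereal" where
  "worst_case_cost P g =
     lim (\<lambda>T. SUP cs\<in>cost_range P g T. ereal (\<Sum>t\<le>T. discount P ^ t * cs ! t))"

text \<open>The samples that conditioning on \<open>m\<^sub>t\<close> (or on \<open>(m\<^sub>t, u\<^sub>t)\<close>) leaves.\<close>

definition cond_samples :: "('o, 'e) system \<Rightarrow> 'e memory \<Rightarrow> 'o set" where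
  "cond_samples P m = {\<omega>\<in>Samples P. memory P (snd m) \<omega> = m}"

definition feasible :: "('o, 'e) system \<Rightarrow> nat \<Rightarrow> 'e memory \<Rightarrow> bool" where
  "feasible P t m \<longleftrightarrow> m \<in> memory_space P t \<and> cond_samples P m \<noteq> {}"

definition strategy_value :: "('o, 'e) system \<Rightarrow> nat \<Rightarrow> 'e strategy \<Rightarrow> 'e memory \<Rightarrow> ereal" where
  "strategy_value P t g m =
     (SUP (a, c)\<in>(\<lambda>\<omega>. (accrued_cost P (snd m) \<omega> t, cost_to_go P g (snd m) \<omega> t)) ` cond_samples P m.
        ereal (a + discount P ^ t * c))"

definition optimal_value :: "('o, 'e) system \<Rightarrow> nat \<Rightarrow> 'e memory \<Rightarrow> ereal" where
  "optimal_value P t m = (INF g\<in>strategies P. strategy_value P t g m)"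


subsection \<open>Information states\<close>

text \<open>The indicator of a range \<open>R = [[X|y]]\<close>.\<close>

definition range_indicator :: "'x set \<Rightarrow> 'x \<Rightarrow> ereal" where
  "range_indicator R x = (if x \<in> R then 0 else - \<infinity>)"

text \<open>
  The conditional accrued distribution \<open>r\<^sub>t(x|y)\<close> of \<open>X\<close>; here \<open>\<Omega>'\<close> is the set of samples
  compatible with \<open>y\<close>, and \<open>X\<close> and \<open>A\<close> (the accrued cost) are evaluated under the given actions.
\<close>

definition accrued_dist ::
    "('o, 'e) system \<Rightarrow> 'o set \<Rightarrow> ('o \<Rightarrow> real) \<Rightarrow> ('o \<Rightarrow> 'x) \<Rightarrow> 'x \<Rightarrow> ereal" where
  "accrued_dist P \<Omega>' A X x =
     (SUP a\<in>{0..a_max P}. ereal a + range_indicator ((\<lambda>\<omega>. (X \<omega>, A \<omega>)) ` \<Omega>') (x, a)) -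
     (SUP a\<in>{0..a_max P}. ereal a + range_indicator (A ` \<Omega>') a)"

definition cost_info_dist ::
    "('o, 'e) system \<Rightarrow> (nat \<Rightarrow> 'e memory \<Rightarrow> 's) \<Rightarrow> nat \<Rightarrow> 'e memory \<Rightarrow> 'e \<Rightarrow> real \<Rightarrow> 's \<Rightarrow> ereal" where
  "cost_info_dist P \<sigma> t m u c s' =
     accrued_dist P (cond_samples P m)
       (\<lambda>\<omega>. accrued_cost P (snd m) \<omega> t)
       (\<lambda>\<omega>. (cost P (snd m @ [u]) \<omega> t, \<sigma> (Suc t) (memory P (snd m @ [u]) \<omega>)))
       (c, s')"

text \<open>\<open>\<rho> c s' s u\<close> is \<open>\<rho>(c, s' | s, u)\<close>.\<close>

definition cost_distribution ::
    "('o, 'e) system \<Rightarrow> 's set \<Rightarrow> (real \<Rightarrow> 's \<Rightarrow> 's \<Rightarrow> 'e \<Rightarrow> ereal) \<Rightarrow> bool" where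
  "cost_distribution P S \<rho> \<longleftrightarrow>
     (\<forall>c\<in>Costs P. \<forall>s'\<in>S. \<forall>s\<in>S. \<forall>u\<in>Actions P.
        \<rho> c s' s u \<in> {- \<infinity>} \<union> {ereal (- a_max P)..0}) \<and>
     (\<forall>s\<in>S. \<forall>u\<in>Actions P. (SUP (c, s')\<in>Costs P \<times> S. \<rho> c s' s u) = 0)"

definition information_state ::
    "('o, 'e) system \<Rightarrow> 's::metric_space set \<Rightarrow> (nat \<Rightarrow> 'e memory \<Rightarrow> 's) \<Rightarrow>
     (real \<Rightarrow> 's \<Rightarrow> 's \<Rightarrow> 'e \<Rightarrow> ereal) \<Rightarrow> bool" where
  "information_state P S \<sigma> \<rho> \<longleftrightarrow>
     bounded S \<and>
     (\<forall>t. \<forall>m\<in>memory_space P t. \<sigma> t m \<in> S) \<and>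
     cost_distribution P S \<rho> \<and>
     (\<forall>t m. feasible P t m \<longrightarrow>
        (\<forall>u\<in>Actions P. \<forall>c\<in>Costs P. \<forall>s'\<in>S.
           cost_info_dist P \<sigma> t m u c s' = \<rho> c s' (\<sigma> t m) u))"


subsection \<open>The dynamic programming operator\<close>

definition dp_objective ::
    "('o, 'e) system \<Rightarrow> 's set \<Rightarrow> (real \<Rightarrow> 's \<Rightarrow> 's \<Rightarrow> 'e \<Rightarrow> ereal) \<Rightarrow>
     ('s \<Rightarrow> real \<Rightarrow> real) \<Rightarrow> 's \<Rightarrow> real \<Rightarrow> 'e \<Rightarrow> ereal" where
  "dp_objective P S \<rho> \<Lambda> s z u =
     (SUP (c, s')\<in>Costs P \<times> S.
        ereal (c + discount P * \<Lambda> s' (discount P * z)) + \<rho> c s' s u / ereal z)"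

text \<open>
  The conversion to a real number loses nothing: the infimum is finite for \<open>\<Lambda>\<close> bounded on
  \<open>S \<times> (0,1]\<close>, \<open>s \<in> S\<close> and \<open>z \<in> (0,1]\<close> (lemma \<open>ereal_dp_operator\<close>).
\<close>

definition dp_operator ::
    "('o, 'e) system \<Rightarrow> 's set \<Rightarrow> (real \<Rightarrow> 's \<Rightarrow> 's \<Rightarrow> 'e \<Rightarrow> ereal) \<Rightarrow>
     ('s \<Rightarrow> real \<Rightarrow> real) \<Rightarrow> 's \<Rightarrow> real \<Rightarrow> real" where
  "dp_operator P S \<rho> \<Lambda> s z = real_of_ereal (INF u\<in>Actions P. dp_objective P S \<rho> \<Lambda> s z u)"

definition dp_iterate ::
    "('o, 'e) system \<Rightarrow> 's set \<Rightarrow> (real \<Rightarrow> 's \<Rightarrow> 's \<Rightarrow> 'e \<Rightarrow> ereal) \<Rightarrow> nat \<Rightarrow> 's \<Rightarrow> real \<Rightarrow> real" where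
  "dp_iterate P S \<rho> n = (dp_operator P S \<rho> ^^ n) (\<lambda>s z. 0)"

text \<open>The limit exists and is the unique bounded fixed point of \<open>\<T>\<close> (lemmas \<open>dp_limit\<close>, \<open>dp_limit_unique\<close>).\<close>

definition dp_limit ::
    "('o, 'e) system \<Rightarrow> 's set \<Rightarrow> (real \<Rightarrow> 's \<Rightarrow> 's \<Rightarrow> 'e \<Rightarrow> ereal) \<Rightarrow> 's \<Rightarrow> real \<Rightarrow> real" where
  "dp_limit P S \<rho> s z = lim (\<lambda>n. dp_iterate P S \<rho> n s z)"

definition infimum_achieved ::
    "('o, 'e) system \<Rightarrow> 's set \<Rightarrow> (real \<Rightarrow> 's \<Rightarrow> 's \<Rightarrow> 'e \<Rightarrow> ereal) \<Rightarrow> ('s \<Rightarrow> real \<Rightarrow> real) \<Rightarrow> bool" where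
  "infimum_achieved P S \<rho> \<Lambda> \<longleftrightarrow>
     (\<forall>s\<in>S. \<forall>z\<in>{0<..1}. \<exists>u\<in>Actions P.
        dp_objective P S \<rho> \<Lambda> s z u = (INF u'\<in>Actions P. dp_objective P S \<rho> \<Lambda> s z u'))"


subsection \<open>Well-definedness of the operator and of the limit\<close>

lemma c_max_bounds:
  assumes "well_posed P"
  shows "c \<in> Costs P \<Longrightarrow> 0 \<le> c" "c \<in> Costs P \<Longrightarrow> c \<le> c_max P"
    "0 \<le> c_max P" "0 < discount P" "discount P < 1"
    "0 \<le> a_max P" "c_max P + discount P * a_max P = a_max P"
proof -
  have C: "Costs P \<subseteq> {0..}" "bdd_above (Costs P)" "Costs P \<noteq> {}"
    and \<gamma>: "0 < discount P" "discount P < 1"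
    using assms by (auto simp: well_posed_def bounded_imp_bdd_above)
  show 1: "c \<in> Costs P \<Longrightarrow> 0 \<le> c" for c using C by auto
  show 2: "c \<in> Costs P \<Longrightarrow> c \<le> c_max P" for c
    unfolding c_max_def by (rule cSup_upper[OF _ C(2)])
  show 3: "0 \<le> c_max P" using 1 2 C(3) by (meson all_not_in_conv order_trans)
  show "0 < discount P" "discount P < 1" using \<gamma> .
  show "0 \<le> a_max P" using 3 \<gamma> by (simp add: a_max_def)
  show "c_max P + discount P * a_max P = a_max P"
    using \<gamma> by (simp add: a_max_def field_simps)
qed

context
  fixes P :: "('o, 'e::metric_space) system" and S :: "'s set"
    and \<rho> :: "real \<Rightarrow> 's \<Rightarrow> 's \<Rightarrow> 'e \<Rightarrow> ereal"
  assumes wp: "well_posed P" and cd: "cost_distribution P S \<rho>"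
begin

lemma scaled_discount: "z \<in> {0<..1} \<Longrightarrow> discount P * z \<in> {0<..1}"
  using c_max_bounds(4,5)[OF wp] by (auto intro: mult_le_one)

lemma dp_objective_bounds:
  assumes \<Lambda>: "\<forall>s\<in>S. \<forall>z\<in>{0<..1}. \<bar>\<Lambda> s z\<bar> \<le> B"
    and s: "s \<in> S" and z: "z \<in> {0<..1}" and u: "u \<in> Actions P"
  shows "ereal (- (discount P * B)) \<le> dp_objective P S \<rho> \<Lambda> s z u"
    and "dp_objective P S \<rho> \<Lambda> s z u \<le> ereal (c_max P + discount P * B)"
proof -
  note cb = c_max_bounds[OF wp]
  have z0: "0 < z" using z by simp
  have \<rho>0: "\<rho> c s' s u \<le> 0" if "c \<in> Costs P" "s' \<in> S" for c s'
    using cd that s u unfolding cost_distribution_def by fastforce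
  have bd: "\<bar>discount P * \<Lambda> s' (discount P * z)\<bar> \<le> discount P * B" if "s' \<in> S" for s'
    using \<Lambda>[rule_format, OF that scaled_discount[OF z]] cb(4) by (simp add: abs_mult)
  show "dp_objective P S \<rho> \<Lambda> s z u \<le> ereal (c_max P + discount P * B)"
    unfolding dp_objective_def
  proof (rule SUP_least, clarify)
    fix c s' assume h: "c \<in> Costs P" "s' \<in> S"
    have "\<rho> c s' s u / ereal z \<le> 0"
      using \<rho>0[OF h] z0 by (cases "\<rho> c s' s u") (auto simp: divide_nonpos_pos)
    then have "ereal (c + discount P * \<Lambda> s' (discount P * z)) + \<rho> c s' s u / ereal z
        \<le> ereal (c_max P + discount P * B) + 0"
      using cb(2)[OF h(1)] bd[OF h(2)] by (intro add_mono) auto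
    then show "ereal (c + discount P * \<Lambda> s' (discount P * z)) + \<rho> c s' s u / ereal z
        \<le> ereal (c_max P + discount P * B)" by simp
  qed
  show "ereal (- (discount P * B)) \<le> dp_objective P S \<rho> \<Lambda> s z u"
  proof (rule ereal_le_epsilon2)
    fix e :: real assume e: "0 < e"
    have "(SUP (c, s')\<in>Costs P \<times> S. \<rho> c s' s u) = 0"
      using cd s u unfolding cost_distribution_def by blast
    then have "ereal (- (e * z)) < (SUP (c, s')\<in>Costs P \<times> S. \<rho> c s' s u)"
      using e z0 by simp
    then obtain c s' where h: "c \<in> Costs P" "s' \<in> S" and r: "ereal (- (e * z)) < \<rho> c s' s u"
      unfolding less_SUP_iff by auto
    obtain x where x: "\<rho> c s' s u = ereal x"
      using r \<rho>0[OF h] by (cases "\<rho> c s' s u") auto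
    have "- e \<le> x / z" using r z0 unfolding x by (simp add: field_simps)
    then have "ereal (- (discount P * B)) \<le>
        ereal (c + discount P * \<Lambda> s' (discount P * z)) + \<rho> c s' s u / ereal z + ereal e"
      using bd[OF h(2)] cb(1)[OF h(1)] z0 by (simp add: x)
    also have "\<dots> \<le> dp_objective P S \<rho> \<Lambda> s z u + ereal e"
      unfolding dp_objective_def using h by (intro add_right_mono SUP_upper2[of "(c, s')"]) auto
    finally show "ereal (- (discount P * B)) \<le> dp_objective P S \<rho> \<Lambda> s z u + ereal e" .
  qed
qed

lemma ereal_dp_operator:
  assumes \<Lambda>: "\<forall>s\<in>S. \<forall>z\<in>{0<..1}. \<bar>\<Lambda> s z\<bar> \<le> B"
    and s: "s \<in> S" and z: "z \<in> {0<..1}"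
  shows "ereal (dp_operator P S \<rho> \<Lambda> s z) = (INF u\<in>Actions P. dp_objective P S \<rho> \<Lambda> s z u)"
    and "\<bar>dp_operator P S \<rho> \<Lambda> s z\<bar> \<le> c_max P + discount P * B"
proof -
  note cb = c_max_bounds[OF wp]
  let ?I = "INF u\<in>Actions P. dp_objective P S \<rho> \<Lambda> s z u"
  obtain u where u: "u \<in> Actions P" using wp by (auto simp: well_posed_def)
  have lo: "ereal (- (discount P * B)) \<le> ?I"
    by (rule INF_greatest) (rule dp_objective_bounds[OF \<Lambda> s z])
  have hi: "?I \<le> ereal (c_max P + discount P * B)"
    using INF_lower[OF u] dp_objective_bounds(2)[OF \<Lambda> s z u] by (rule order_trans)
  obtain x where x: "?I = ereal x" using lo hi by (cases ?I) auto
  show "ereal (dp_operator P S \<rho> \<Lambda> s z) = ?I" unfolding dp_operator_def x by simp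
  show "\<bar>dp_operator P S \<rho> \<Lambda> s z\<bar> \<le> c_max P + discount P * B"
    using lo hi cb(3) unfolding dp_operator_def x by simp
qed

lemma dp_operator_le:
  assumes \<Lambda>: "\<forall>s\<in>S. \<forall>z\<in>{0<..1}. \<bar>\<Lambda> s z\<bar> \<le> B"
    and \<Lambda>': "\<forall>s\<in>S. \<forall>z\<in>{0<..1}. \<bar>\<Lambda>' s z\<bar> \<le> B'"
    and D: "\<forall>s\<in>S. \<forall>z\<in>{0<..1}. \<Lambda> s z \<le> \<Lambda>' s z + D"
    and s: "s \<in> S" and z: "z \<in> {0<..1}"
  shows "dp_operator P S \<rho> \<Lambda> s z \<le> dp_operator P S \<rho> \<Lambda>' s z + discount P * D"
proof -
  note cb = c_max_bounds[OF wp]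
  have obj: "dp_objective P S \<rho> \<Lambda> s z u \<le> dp_objective P S \<rho> \<Lambda>' s z u + ereal (discount P * D)" for u
    unfolding dp_objective_def
  proof (rule SUP_least, clarify)
    fix c s' assume h: "c \<in> Costs P" "s' \<in> S"
    have "discount P * \<Lambda> s' (discount P * z) \<le> discount P * (\<Lambda>' s' (discount P * z) + D)"
      using D[rule_format, OF h(2) scaled_discount[OF z]] cb(4) by simp
    then have "ereal (c + discount P * \<Lambda> s' (discount P * z)) + \<rho> c s' s u / ereal z
        \<le> ereal (c + discount P * \<Lambda>' s' (discount P * z) + discount P * D) + \<rho> c s' s u / ereal z"
      by (intro add_right_mono) (simp add: algebra_simps)
    also have "\<dots> = (ereal (c + discount P * \<Lambda>' s' (discount P * z)) + \<rho> c s' s u / ereal z)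
        + ereal (discount P * D)"
      by (simp add: ac_simps flip: plus_ereal.simps(1))
    also have "\<dots> \<le> (SUP (c, s')\<in>Costs P \<times> S. ereal (c + discount P * \<Lambda>' s' (discount P * z)) + \<rho> c s' s u / ereal z)
        + ereal (discount P * D)"
      using h by (intro add_right_mono SUP_upper2[of "(c, s')"]) auto
    finally show "ereal (c + discount P * \<Lambda> s' (discount P * z)) + \<rho> c s' s u / ereal z \<le> \<dots>" .
  qed
  have "ereal (dp_operator P S \<rho> \<Lambda> s z - discount P * D)
      \<le> (INF u\<in>Actions P. dp_objective P S \<rho> \<Lambda>' s z u)"
  proof (rule INF_greatest)
    fix u assume u: "u \<in> Actions P"
    have "ereal (dp_operator P S \<rho> \<Lambda> s z) \<le> dp_objective P S \<rho> \<Lambda> s z u"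
      unfolding ereal_dp_operator(1)[OF \<Lambda> s z] by (rule INF_lower[OF u])
    also note obj
    finally show "ereal (dp_operator P S \<rho> \<Lambda> s z - discount P * D) \<le> dp_objective P S \<rho> \<Lambda>' s z u"
      by (cases "dp_objective P S \<rho> \<Lambda>' s z u") auto
  qed
  then show ?thesis unfolding ereal_dp_operator(1)[OF \<Lambda>' s z, symmetric] by simp
qed

lemma dp_operator_contraction:
  assumes "\<forall>s\<in>S. \<forall>z\<in>{0<..1}. \<bar>\<Lambda> s z\<bar> \<le> B"
    and "\<forall>s\<in>S. \<forall>z\<in>{0<..1}. \<bar>\<Lambda>' s z\<bar> \<le> B'"
    and D: "\<forall>s\<in>S. \<forall>z\<in>{0<..1}. \<bar>\<Lambda> s z - \<Lambda>' s z\<bar> \<le> D"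
    and "s \<in> S" "z \<in> {0<..1}"
  shows "\<bar>dp_operator P S \<rho> \<Lambda> s z - dp_operator P S \<rho> \<Lambda>' s z\<bar> \<le> discount P * D"
proof -
  have *: "\<forall>s\<in>S. \<forall>z\<in>{0<..1}. \<Lambda> s z \<le> \<Lambda>' s z + D"
    "\<forall>s\<in>S. \<forall>z\<in>{0<..1}. \<Lambda>' s z \<le> \<Lambda> s z + D"
    using D by (auto simp: abs_le_iff algebra_simps)
  show ?thesis
    using dp_operator_le[OF assms(1,2) *(1) assms(4,5)] dp_operator_le[OF assms(2,1) *(2) assms(4,5)]
    by auto
qed

lemma dp_iterate_Suc: "dp_iterate P S \<rho> (Suc n) = dp_operator P S \<rho> (dp_iterate P S \<rho> n)"
  by (simp add: dp_iterate_def)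

lemma dp_iterate_bound: "\<forall>s\<in>S. \<forall>z\<in>{0<..1}. \<bar>dp_iterate P S \<rho> n s z\<bar> \<le> a_max P"
proof (induction n)
  case 0
  then show ?case using c_max_bounds(6)[OF wp] by (simp add: dp_iterate_def)
next
  case (Suc n)
  show ?case
    using ereal_dp_operator(2)[OF Suc.IH] c_max_bounds(7)[OF wp] by (simp add: dp_iterate_Suc)
qed

lemma dp_iterate_diff:
  assumes \<Lambda>: "\<forall>s\<in>S. \<forall>z\<in>{0<..1}. \<bar>\<Lambda> s z\<bar> \<le> B"
  shows "(\<forall>s\<in>S. \<forall>z\<in>{0<..1}. \<bar>(dp_operator P S \<rho> ^^ n) \<Lambda> s z\<bar> \<le> max B (a_max P)) \<and>
    (\<forall>s\<in>S. \<forall>z\<in>{0<..1}.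
      \<bar>(dp_operator P S \<rho> ^^ n) \<Lambda> s z - dp_iterate P S \<rho> n s z\<bar> \<le> discount P ^ n * B)"
proof (induction n)
  case 0
  then show ?case using \<Lambda> by (force simp: dp_iterate_def)
next
  case (Suc n)
  note cb = c_max_bounds[OF wp]
  let ?M = "max B (a_max P)"
  have "(1 - discount P) * a_max P \<le> (1 - discount P) * ?M"
    using cb(5) by (intro mult_left_mono) auto
  then have "c_max P + discount P * ?M \<le> ?M" using cb(7) by (simp add: algebra_simps)
  then show ?case
    using ereal_dp_operator(2)[OF conjunct1[OF Suc.IH]]
      dp_operator_contraction[OF conjunct1[OF Suc.IH] dp_iterate_bound conjunct2[OF Suc.IH]]
    by (fastforce simp: dp_iterate_Suc mult.assoc)
qed

lemma dp_limit:
  assumes s: "s \<in> S" and z: "z \<in> {0<..1}"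
  shows "(\<lambda>n. dp_iterate P S \<rho> n s z) \<longlonglongrightarrow> dp_limit P S \<rho> s z"
    and "\<bar>dp_limit P S \<rho> s z\<bar> \<le> a_max P"
    and "dp_operator P S \<rho> (dp_limit P S \<rho>) s z = dp_limit P S \<rho> s z"
proof -
  note cb = c_max_bounds[OF wp]
  have null: "(\<lambda>n. discount P ^ n * a_max P) \<longlonglongrightarrow> 0"
    using cb by (auto intro!: tendsto_mult_left_zero LIMSEQ_power_zero)
  have diff: "\<bar>dp_iterate P S \<rho> (n + m) s z - dp_iterate P S \<rho> n s z\<bar> \<le> discount P ^ n * a_max P"
    if "s \<in> S" "z \<in> {0<..1}" for n m s z
    using conjunct2[OF dp_iterate_diff[OF dp_iterate_bound[of m]], of n] that
    by (simp add: dp_iterate_def funpow_add)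
  have lim: "(\<lambda>n. dp_iterate P S \<rho> n s z) \<longlonglongrightarrow> dp_limit P S \<rho> s z"
    if h: "s \<in> S" "z \<in> {0<..1}" for s z
  proof -
    have "Cauchy (\<lambda>n. dp_iterate P S \<rho> n s z)"
    proof (rule metric_CauchyI)
      fix e :: real assume "0 < e"
      then obtain N where N: "discount P ^ N * a_max P < e / 2"
        using order_tendstoD(2)[OF null, of "e / 2"] by (auto simp: eventually_sequentially)
      have "dist (dp_iterate P S \<rho> m s z) (dp_iterate P S \<rho> n s z) < e" if "N \<le> m" "N \<le> n" for m n
        using diff[OF h, of N "m - N"] diff[OF h, of N "n - N"] N that by (simp add: dist_real_def)
      then show "\<exists>M. \<forall>m\<ge>M. \<forall>n\<ge>M. dist (dp_iterate P S \<rho> m s z) (dp_iterate P S \<rho> n s z) < e"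
        by blast
    qed
    then show ?thesis unfolding dp_limit_def
      by (simp add: Cauchy_convergent_iff convergent_LIMSEQ_iff)
  qed
  have bound: "\<bar>dp_limit P S \<rho> s z\<bar> \<le> a_max P" if h: "s \<in> S" "z \<in> {0<..1}" for s z
    by (rule LIMSEQ_le_const2[OF tendsto_rabs[OF lim[OF h]]]) (use dp_iterate_bound h in blast)
  have close: "\<bar>dp_limit P S \<rho> s z - dp_iterate P S \<rho> n s z\<bar> \<le> discount P ^ n * a_max P"
    if h: "s \<in> S" "z \<in> {0<..1}" for s z n
  proof (rule LIMSEQ_le_const2)
    show "(\<lambda>m. \<bar>dp_iterate P S \<rho> m s z - dp_iterate P S \<rho> n s z\<bar>)
        \<longlonglongrightarrow> \<bar>dp_limit P S \<rho> s z - dp_iterate P S \<rho> n s z\<bar>"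
      by (intro tendsto_intros lim h)
    show "\<exists>N. \<forall>m\<ge>N. \<bar>dp_iterate P S \<rho> m s z - dp_iterate P S \<rho> n s z\<bar> \<le> discount P ^ n * a_max P"
      using diff[OF h, of n] by (metis le_add_diff_inverse)
  qed
  show "(\<lambda>n. dp_iterate P S \<rho> n s z) \<longlonglongrightarrow> dp_limit P S \<rho> s z" using lim[OF s z] .
  show "\<bar>dp_limit P S \<rho> s z\<bar> \<le> a_max P" using bound[OF s z] .
  have step: "\<bar>dp_iterate P S \<rho> (Suc n) s z - dp_operator P S \<rho> (dp_limit P S \<rho>) s z\<bar>
      \<le> discount P * (discount P ^ n * a_max P)" for n
  proof -
    have "\<forall>s\<in>S. \<forall>z\<in>{0<..1}. \<bar>dp_limit P S \<rho> s z\<bar> \<le> a_max P"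
      "\<forall>s\<in>S. \<forall>z\<in>{0<..1}. \<bar>dp_limit P S \<rho> s z - dp_iterate P S \<rho> n s z\<bar> \<le> discount P ^ n * a_max P"
      using bound close by blast+
    from dp_operator_contraction[OF this(1) dp_iterate_bound this(2) s z]
    show ?thesis by (simp add: dp_iterate_Suc abs_minus_commute)
  qed
  have "(\<lambda>n. dp_iterate P S \<rho> (Suc n) s z - dp_operator P S \<rho> (dp_limit P S \<rho>) s z) \<longlonglongrightarrow> 0"
    by (rule Lim_null_comparison[OF _ tendsto_mult_right_zero[OF null, of "discount P"]])
      (use step in \<open>auto intro: always_eventually\<close>)
  then have "(\<lambda>n. dp_iterate P S \<rho> (Suc n) s z) \<longlonglongrightarrow> dp_operator P S \<rho> (dp_limit P S \<rho>) s z"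
    by (simp add: LIM_zero_iff)
  then show "dp_operator P S \<rho> (dp_limit P S \<rho>) s z = dp_limit P S \<rho> s z"
    using LIMSEQ_Suc[OF lim[OF s z]] LIMSEQ_unique by blast
qed

lemma dp_limit_unique:
  assumes \<Lambda>: "\<forall>s\<in>S. \<forall>z\<in>{0<..1}. \<bar>\<Lambda> s z\<bar> \<le> B"
    and fp: "\<forall>s\<in>S. \<forall>z\<in>{0<..1}. dp_operator P S \<rho> \<Lambda> s z = \<Lambda> s z"
    and "s \<in> S" "z \<in> {0<..1}"
  shows "\<Lambda> s z = dp_limit P S \<rho> s z"
proof -
  note cb = c_max_bounds[OF wp]
  have lb: "\<forall>s\<in>S. \<forall>z\<in>{0<..1}. \<bar>dp_limit P S \<rho> s z\<bar> \<le> a_max P"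
    using dp_limit(2) by blast
  have ind: "\<forall>s\<in>S. \<forall>z\<in>{0<..1}. \<bar>\<Lambda> s z - dp_limit P S \<rho> s z\<bar> \<le> discount P ^ n * (B + a_max P)" for n
  proof (induction n)
    case 0
    then show ?case using \<Lambda> lb by fastforce
  next
    case (Suc n)
    show ?case
      using dp_operator_contraction[OF \<Lambda> lb Suc.IH] by (simp add: fp dp_limit(3) mult.assoc)
  qed
  have "(\<lambda>n. discount P ^ n * (B + a_max P)) \<longlonglongrightarrow> 0"
    using cb by (auto intro!: tendsto_mult_left_zero LIMSEQ_power_zero)
  then have "\<bar>\<Lambda> s z - dp_limit P S \<rho> s z\<bar> \<le> 0"
    by (rule LIMSEQ_le_const) (use ind assms(3,4) in blast)
  then show ?thesis by simp
qed

end

end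

theory Submission
  imports Defs
begin

text \<open>
  The proof compares every strategy with one candidate value function on memories,
  \<open>W\<^sub>t(m) = \<alpha>(m) + \<gamma>\<^sup>t \<Lambda>\<^sup>\<infinity>(\<sigma>\<^sub>t(m), \<gamma>\<^sup>t)\<close>,
  where \<open>\<alpha>(m)\<close> is the largest accrued cost compatible with the memory \<open>m\<close> (\<open>dp_value\<close>,
  \<open>worst_accrued\<close>). Worst-case values do not split into a past and a future part, since the sample that
  maximizes the accrued cost may not be the one with an expensive future; the accrued distribution
  records exactly this trade-off. Indeed \<open>\<alpha>(m) + \<rho>(c, s' | \<sigma>\<^sub>t(m), u)\<close> is the largest accrued
  cost among the samples that go on to produce the cost \<open>c\<close> and the next information state \<open>s'\<close>
  (\<open>worst_accrued_plus_rho\<close>). Dividing \<open>\<rho>\<close> by \<open>z = \<gamma>\<^sup>t\<close> in the operator puts this term on the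
  scale of the cost-to-go seen at time \<open>t\<close>, so \<open>\<alpha>(m) + \<gamma>\<^sup>t\<close> times the dynamic programming objective at
  \<open>u\<close> is the supremum of \<open>W\<^sub>t\<^sub>+\<^sub>1\<close> over the memories that can follow \<open>(m, u)\<close>.

  Since \<open>\<Lambda>\<^sup>\<infinity>\<close> is a fixed point, this gives two one-step facts. Whatever the action, some sample
  compatible with \<open>m\<close> leads to a memory where \<open>W\<close> has dropped by an arbitrarily small amount at most
  (\<open>dp_value_step_exists\<close>); for a minimizing action, \<open>W\<close> increases on no sample
  (\<open>dp_value_step_minimizer\<close>). Iterating them along trajectories and using that \<open>W\<^sub>n\<close> differs from the
  accrued worst case by at most \<open>\<gamma>\<^sup>n a\<^sup>m\<^sup>a\<^sup>x\<close> yields, for \<open>n\<close> tending to infinity, that \<open>W\<^sub>0\<close> is a lower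
  bound for the worst total cost of every strategy and an upper bound for that of the minimizing one.
  Both conclusions follow, because the value of a strategy at \<open>y\<^sub>0\<close> and its worst-case discounted cost are
  suprema of the same total cost, over the samples that produce \<open>y\<^sub>0\<close> and over all samples
  respectively (\<open>strategy_value_eq\<close>, \<open>worst_case_cost_eq\<close>).
\<close>


section \<open>Trajectories\<close>

lemma length_actions [simp]: "length (actions P g us \<omega> n) = length us + n"
  by (induction n) (simp_all add: Let_def)

lemma take_actions: "k \<le> n \<Longrightarrow> take (length us + k) (actions P g us \<omega> n) = actions P g us \<omega> k"
proof (induction n)
  case (Suc n)
  show ?case
  proof (cases "k = Suc n")
    case True
    then show ?thesis by (metis length_actions order_refl take_all)
  next
    case False
    then show ?thesis using Suc by (simp add: Let_def)
  qed
qed simp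

lemma observation_append:
  "k \<le> length us \<Longrightarrow> observation P (us @ vs) \<omega> k = observation P us \<omega> k"
  by (cases k) simp_all

lemma cost_append: "k < length us \<Longrightarrow> cost P (us @ vs) \<omega> k = cost P us \<omega> k"
  by (simp add: cost_def)

lemma memory_snoc:
  "memory P (us @ [u]) \<omega> =
     (fst (memory P us \<omega>) @ [observation P (us @ [u]) \<omega> (Suc (length us))], us @ [u])"
  by (simp add: memory_def observation_append del: observation.simps)

lemma snd_memory [simp]: "snd (memory P us \<omega>) = us"
  by (simp add: memory_def)

lemma memory_prefix:
  assumes "memory P (us @ [u]) \<omega>' = memory P (us @ [u]) \<omega>"
  shows "memory P us \<omega>' = memory P us \<omega>"
  using assms by (simp add: memory_snoc prod_eq_iff)

lemma accrued_cost_snoc: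
  "accrued_cost P (us @ [u]) \<omega> (Suc (length us)) =
     accrued_cost P us \<omega> (length us) + discount P ^ length us * cost P (us @ [u]) \<omega> (length us)"
  by (simp add: accrued_cost_def cost_append)

lemma memory_in_cond_samples: "\<omega> \<in> Samples P \<Longrightarrow> \<omega> \<in> cond_samples P (memory P us \<omega>)"
  by (simp add: cond_samples_def)

lemma cond_samplesD:
  assumes "\<omega> \<in> cond_samples P m"
  shows "\<omega> \<in> Samples P" "memory P (snd m) \<omega> = m"
  using assms by (simp_all add: cond_samples_def)

definition history :: "('o, 'e) system \<Rightarrow> 'e strategy \<Rightarrow> 'o \<Rightarrow> nat \<Rightarrow> 'e memory" where
  "history P g \<omega> n = memory P (actions P g [] \<omega> n) \<omega>"

lemma snd_history [simp]: "snd (history P g \<omega> n) = actions P g [] \<omega> n"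
  by (simp add: history_def)

lemma actions_Suc_history:
  "actions P g us \<omega> (Suc n) = actions P g us \<omega> n @ [g (length us + n) (memory P (actions P g us \<omega> n) \<omega>)]"
  by (simp add: Let_def)

text \<open>
  By induction on the time: two samples with the same past observations have led \<open>g\<close> to the same
  actions. This is what allows a sample compatible with the current memory to be replaced
  by another one without changing the past.
\<close>

lemma history_agree:
  assumes "\<omega>' \<in> cond_samples P (history P g \<omega> n)"
  shows "actions P g [] \<omega>' n = actions P g [] \<omega> n" and "history P g \<omega>' n = history P g \<omega> n"
    and "\<omega>' \<in> cond_samples P (memory P [] \<omega>)"
proof -
  have "memory P (actions P g [] \<omega> n) \<omega>' = memory P (actions P g [] \<omega> n) \<omega> \<Longrightarrow>
     actions P g [] \<omega>' n = actions P g [] \<omega> n \<and> memory P [] \<omega>' = memory P [] \<omega>"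
  proof (induction n)
    case (Suc n)
    have m: "memory P (actions P g [] \<omega> n) \<omega>' = memory P (actions P g [] \<omega> n) \<omega>"
      using Suc.prems unfolding actions_Suc_history by (rule memory_prefix)
    with Suc.IH show ?case by (simp add: Let_def)
  qed simp
  with assms show "actions P g [] \<omega>' n = actions P g [] \<omega> n"
    "history P g \<omega>' n = history P g \<omega> n" "\<omega>' \<in> cond_samples P (memory P [] \<omega>)"
    by (auto simp: cond_samples_def history_def)
qed

lemma history_Suc:
  "history P g \<omega> (Suc n) =
     memory P (snd (history P g \<omega> n) @ [g n (history P g \<omega> n)]) \<omega>"
  by (simp add: history_def Let_def)

abbreviation total_cost :: "('o, 'e) system \<Rightarrow> 'e strategy \<Rightarrow> 'o \<Rightarrow> real" where
  "total_cost P g \<omega> \<equiv> cost_to_go P g [] \<omega> 0"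

lemma accrued_cost_actions:
  "accrued_cost P (actions P g [] \<omega> n) \<omega> n = (\<Sum>l<n. discount P ^ l * cost_under P g [] \<omega> l)"
  unfolding accrued_cost_def cost_under_def
proof (intro sum.cong refl arg_cong2[of _ _ _ _ "(*)"])
  fix l assume "l \<in> {..<n}"
  then have "take (Suc l) (actions P g [] \<omega> n) = actions P g [] \<omega> (Suc l)"
    using take_actions[of "Suc l" n "[]" P g \<omega>] by simp
  then show "cost P (actions P g [] \<omega> n) \<omega> l = cost P (actions P g [] \<omega> (Suc l)) \<omega> l"
    using cost_def length_actions take_all_iff by (metis add_0 le_refl list.size(3))
qed

lemma strategy_value_eq:
  "strategy_value P 0 g ([y], []) = (SUP \<omega>\<in>cond_samples P ([y], []). ereal (total_cost P g \<omega>))"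
  by (simp add: strategy_value_def accrued_cost_def image_image)


section \<open>Ranges and bounds of the trajectories\<close>

lemma take_in_nlists:
  assumes "set us \<subseteq> A" "k \<le> length us"
  shows "take k us \<in> nlists k A"
  using assms set_take_subset[of k us] by (intro nlistsI) auto

lemma strategy_action_in:
  "g \<in> strategies P \<Longrightarrow> feasible P n m \<Longrightarrow> g n m \<in> Actions P"
  by (simp add: strategies_def feasible_def)

context
  fixes P :: "('o, 'e::metric_space) system"
  assumes wp: "well_posed P"
begin

lemma system_maps:
  shows "\<omega> \<in> Samples P \<Longrightarrow> disturbance P t \<omega> \<in> Disturbances P"
    and "w \<in> Disturbances P \<Longrightarrow> obs_init P w \<in> Observations P"
    and "ws \<in> nlists (Suc t) (Disturbances P) \<Longrightarrow> us \<in> nlists (Suc t) (Actions P) \<Longrightarrow>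
      obs_fun P (Suc t) ws us \<in> Observations P"
    and "ws \<in> nlists (Suc t) (Disturbances P) \<Longrightarrow> us \<in> nlists (Suc t) (Actions P) \<Longrightarrow>
      cost_fun P t ws us \<in> Costs P"
  using wp unfolding well_posed_def by simp_all

lemma disturbances_upto_in:
  assumes "\<omega> \<in> Samples P"
  shows "disturbances_upto P t \<omega> \<in> nlists (Suc t) (Disturbances P)"
  using system_maps(1)[OF assms]
  by (auto simp: disturbances_upto_def intro!: nlistsI simp del: upt_Suc)

lemma cost_in:
  assumes "\<omega> \<in> Samples P" "set us \<subseteq> Actions P" "k < length us"
  shows "cost P us \<omega> k \<in> Costs P"
  unfolding cost_def using assms
  by (intro system_maps(4) disturbances_upto_in take_in_nlists) simp_all

lemma observation_in:
  assumes "\<omega> \<in> Samples P" "set us \<subseteq> Actions P" "k \<le> length us"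
  shows "observation P us \<omega> k \<in> Observations P"
proof (cases k)
  case 0
  then show ?thesis using system_maps(1,2) assms(1) by simp
next
  case (Suc j)
  then show ?thesis
    using assms unfolding Suc observation.simps
    by (intro system_maps(3) disturbances_upto_in take_in_nlists) simp_all
qed

lemma memory_in:
  assumes "\<omega> \<in> Samples P" "set us \<subseteq> Actions P"
  shows "memory P us \<omega> \<in> memory_space P (length us)"
proof -
  have "map (observation P us \<omega>) [0..<Suc (length us)] \<in> nlists (Suc (length us)) (Observations P)"
    using observation_in[OF assms] by (intro nlistsI) (auto simp del: upt_Suc)
  moreover have "us \<in> nlists (length us) (Actions P)" using assms(2) by (intro nlistsI) auto
  ultimately show ?thesis unfolding memory_def memory_space_def by blast
qed

lemma feasible_memory:
  assumes "\<omega> \<in> Samples P" "set us \<subseteq> Actions P"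
  shows "feasible P (length us) (memory P us \<omega>)"
  using memory_in[OF assms] memory_in_cond_samples[OF assms(1)] by (auto simp: feasible_def)

lemma actions_in:
  assumes "g \<in> strategies P" "\<omega> \<in> Samples P"
  shows "set (actions P g [] \<omega> n) \<subseteq> Actions P"
proof (induction n)
  case (Suc n)
  have "g n (memory P (actions P g [] \<omega> n) \<omega>) \<in> Actions P"
    using assms(1) memory_in[OF assms(2) Suc.IH] by (simp add: strategies_def)
  with Suc.IH show ?case by (simp add: Let_def)
qed simp

lemma feasible_history:
  assumes "g \<in> strategies P" "\<omega> \<in> Samples P"
  shows "feasible P n (history P g \<omega> n)"
  using feasible_memory[OF assms(2) actions_in[OF assms]] by (simp add: history_def)

text \<open>
  The recursion \<open>c\<^sup>m\<^sup>a\<^sup>x + \<gamma> a\<^sup>m\<^sup>a\<^sup>x = a\<^sup>m\<^sup>a\<^sup>x\<close> makes the bound inductive, so no geometric series has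
  to be summed.
\<close>

lemma discounted_sum_le_a_max:
  assumes "\<And>l. l < t \<Longrightarrow> c l \<le> c_max P"
  shows "(\<Sum>l<t. discount P ^ l * c l) \<le> a_max P"
  using assms
proof (induction t arbitrary: c)
  case 0
  then show ?case using c_max_bounds[OF wp] by simp
next
  case (Suc t)
  note cb = c_max_bounds[OF wp]
  have "(\<Sum>l<Suc t. discount P ^ l * c l) = c 0 + discount P * (\<Sum>l<t. discount P ^ l * c (Suc l))"
    by (subst sum.lessThan_Suc_shift) (simp add: sum_distrib_left mult.assoc)
  also have "\<dots> \<le> c_max P + discount P * a_max P"
    using Suc cb(4) by (intro add_mono mult_left_mono) auto
  finally show ?case using cb(7) by simp
qed

lemma accrued_cost_in:
  assumes "\<omega> \<in> Samples P" "set us \<subseteq> Actions P" "t \<le> length us"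
  shows "accrued_cost P us \<omega> t \<in> {0..a_max P}"
proof -
  note cb = c_max_bounds[OF wp]
  have c: "cost P us \<omega> l \<in> Costs P" if "l < t" for l using cost_in assms that by auto
  show ?thesis
    unfolding accrued_cost_def atLeastAtMost_iff
    using c cb by (auto intro!: sum_nonneg discounted_sum_le_a_max mult_nonneg_nonneg)
qed

lemma cost_under_in:
  assumes "g \<in> strategies P" "\<omega> \<in> Samples P"
  shows "cost_under P g [] \<omega> k \<in> Costs P"
  using cost_in[OF assms(2) actions_in[OF assms]] by (simp add: cost_under_def del: actions.simps)

lemma cost_to_go_sums:
  assumes "g \<in> strategies P" "\<omega> \<in> Samples P"
  shows "(\<lambda>l. discount P ^ l * cost_under P g [] \<omega> l) sums total_cost P g \<omega>"
proof -
  note cb = c_max_bounds[OF wp]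
  have "summable (\<lambda>l. discount P ^ l * cost_under P g [] \<omega> l)"
  proof (rule summable_comparison_test')
    show "summable (\<lambda>l. discount P ^ l * c_max P)"
      using cb by (intro summable_mult2 summable_geometric) simp
    show "norm (discount P ^ l * cost_under P g [] \<omega> l) \<le> discount P ^ l * c_max P" for l
      using cb cost_under_in[OF assms, of l] by (simp add: abs_mult)
  qed
  then show ?thesis unfolding cost_to_go_def by (simp add: summable_sums)
qed

lemma total_cost_bounds:
  assumes "g \<in> strategies P" "\<omega> \<in> Samples P"
  shows "accrued_cost P (actions P g [] \<omega> n) \<omega> n \<le> total_cost P g \<omega>"
    and "total_cost P g \<omega> \<le> accrued_cost P (actions P g [] \<omega> n) \<omega> n + discount P ^ n * a_max P"
proof -
  note cb = c_max_bounds[OF wp]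
  let ?f = "\<lambda>l. discount P ^ l * cost_under P g [] \<omega> l"
  have f: "0 \<le> ?f l" for l using cb cost_under_in[OF assms, of l] by simp
  show "accrued_cost P (actions P g [] \<omega> n) \<omega> n \<le> total_cost P g \<omega>"
    unfolding accrued_cost_actions using sum_le_suminf[of ?f "{..<n}"] cost_to_go_sums[OF assms] f
    by (auto simp: sums_iff)
  show "total_cost P g \<omega> \<le> accrued_cost P (actions P g [] \<omega> n) \<omega> n + discount P ^ n * a_max P"
  proof (rule LIMSEQ_le_const2)
    show "(\<lambda>k. \<Sum>l<k + n. ?f l) \<longlonglongrightarrow> total_cost P g \<omega>"
      using cost_to_go_sums[OF assms] unfolding sums_def by (rule LIMSEQ_ignore_initial_segment)
    have "(\<Sum>l<k + n. ?f l) \<le> accrued_cost P (actions P g [] \<omega> n) \<omega> n + discount P ^ n * a_max P" for k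
    proof -
      have "(\<Sum>l<k + n. ?f l) = (\<Sum>l<n. ?f l) + discount P ^ n * (\<Sum>l<k. discount P ^ l * cost_under P g [] \<omega> (n + l))"
        by (induction k) (simp_all add: algebra_simps power_add)
      also have "\<dots> \<le> (\<Sum>l<n. ?f l) + discount P ^ n * a_max P"
        using cb cost_under_in[OF assms]
        by (intro add_left_mono mult_left_mono discounted_sum_le_a_max) auto
      finally show ?thesis unfolding accrued_cost_actions .
    qed
    then show "\<exists>N. \<forall>k\<ge>N. (\<Sum>l<k + n. ?f l) \<le> accrued_cost P (actions P g [] \<omega> n) \<omega> n + discount P ^ n * a_max P"
      by blast
  qed
qed

lemma discounted_tail_small:
  assumes "0 < e"
  obtains n where "discount P ^ n * a_max P < e"
proof -
  have "(\<lambda>n. discount P ^ n * a_max P) \<longlonglongrightarrow> 0"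
    using c_max_bounds[OF wp] by (auto intro!: tendsto_mult_left_zero LIMSEQ_power_zero)
  from order_tendstoD(2)[OF this assms] that show ?thesis by (auto simp: eventually_sequentially)
qed

text \<open>
  Partial sums increase with the horizon because costs are nonnegative. Hence the limit is a
  supremum, which commutes with the supremum over the samples.
\<close>

lemma worst_case_cost_eq:
  assumes g: "g \<in> strategies P"
  shows "worst_case_cost P g = (SUP \<omega>\<in>Samples P. ereal (total_cost P g \<omega>))"
proof -
  note cb = c_max_bounds[OF wp]
  define F where "F T \<omega> = ereal (\<Sum>t\<le>T. discount P ^ t * cost_under P g [] \<omega> t)" for T \<omega>
  have eq: "(SUP cs\<in>cost_range P g T. ereal (\<Sum>t\<le>T. discount P ^ t * cs ! t)) = (SUP \<omega>\<in>Samples P. F T \<omega>)" for T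
    unfolding cost_range_def F_def image_image
    by (intro SUP_cong refl arg_cong[of _ _ ereal] sum.cong)
      (auto simp del: upt_Suc simp: nth_map)
  have mono: "incseq (\<lambda>T. F T \<omega>)" if "\<omega> \<in> Samples P" for \<omega>
    using cost_under_in[OF g that] cb by (auto intro!: incseq_SucI simp: F_def)
  have lim: "(\<lambda>T. F T \<omega>) \<longlonglongrightarrow> ereal (total_cost P g \<omega>)" if "\<omega> \<in> Samples P" for \<omega>
    using cost_to_go_sums[OF g that] unfolding F_def sums_def_le by simp
  have "incseq (\<lambda>T. SUP \<omega>\<in>Samples P. F T \<omega>)"
    using mono by (auto intro!: incseq_SucI SUP_mono dest: incseq_SucD)
  then have "(\<lambda>T. SUP \<omega>\<in>Samples P. F T \<omega>) \<longlonglongrightarrow> (SUP T. SUP \<omega>\<in>Samples P. F T \<omega>)"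
    by (rule LIMSEQ_SUP)
  also have "(SUP T. SUP \<omega>\<in>Samples P. F T \<omega>) = (SUP \<omega>\<in>Samples P. SUP T. F T \<omega>)"
    by (rule SUP_commute)
  also have "\<dots> = (SUP \<omega>\<in>Samples P. ereal (total_cost P g \<omega>))"
    using LIMSEQ_unique[OF LIMSEQ_SUP[OF mono] lim] by (intro SUP_cong) auto
  finally show ?thesis unfolding worst_case_cost_def eq by (rule limI)
qed

end


section \<open>Worst accrued costs\<close>

text \<open>
  The length of \<open>snd m\<close> is the time of the memory \<open>m\<close>, which is therefore not an argument.
\<close>

definition worst_accrued :: "('o, 'e) system \<Rightarrow> 'e memory \<Rightarrow> real" where
  "worst_accrued P m = (SUP \<omega>\<in>cond_samples P m. accrued_cost P (snd m) \<omega> (length (snd m)))"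

text \<open>
  The indicators turn both suprema over \<open>[0, a\<^sup>m\<^sup>a\<^sup>x]\<close> into suprema over samples. Moving the
  normalizing supremum to the left avoids a subtraction of infinities: it is finite, while
  the right-hand side is \<open>-\<infinity>\<close> when no sample produces \<open>x\<close>.
\<close>

lemma accrued_dist_eq:
  assumes "A ` \<Omega>' \<subseteq> {0..a_max P}" "\<Omega>' \<noteq> {}"
  shows "ereal (Sup (A ` \<Omega>')) + accrued_dist P \<Omega>' A X x = (SUP \<omega>\<in>{\<omega>\<in>\<Omega>'. X \<omega> = x}. ereal (A \<omega>))"
proof -
  have mem: "A \<omega> \<in> {0..a_max P}" if "\<omega> \<in> \<Omega>'" for \<omega>
    using that assms(1) by blast
  have joint: "(SUP a\<in>{0..a_max P}. ereal a + range_indicator ((\<lambda>\<omega>. (X \<omega>, A \<omega>)) ` \<Omega>') (x, a))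
      = (SUP \<omega>\<in>{\<omega>\<in>\<Omega>'. X \<omega> = x}. ereal (A \<omega>))"
  proof (rule antisym)
    show "(SUP a\<in>{0..a_max P}. ereal a + range_indicator ((\<lambda>\<omega>. (X \<omega>, A \<omega>)) ` \<Omega>') (x, a))
        \<le> (SUP \<omega>\<in>{\<omega>\<in>\<Omega>'. X \<omega> = x}. ereal (A \<omega>))"
      by (intro SUP_least) (auto simp: range_indicator_def intro: SUP_upper)
    show "(SUP \<omega>\<in>{\<omega>\<in>\<Omega>'. X \<omega> = x}. ereal (A \<omega>))
        \<le> (SUP a\<in>{0..a_max P}. ereal a + range_indicator ((\<lambda>\<omega>. (X \<omega>, A \<omega>)) ` \<Omega>') (x, a))"
    proof (rule SUP_least)
      fix \<omega> assume "\<omega> \<in> {\<omega>\<in>\<Omega>'. X \<omega> = x}"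
      then show "ereal (A \<omega>)
          \<le> (SUP a\<in>{0..a_max P}. ereal a + range_indicator ((\<lambda>\<omega>. (X \<omega>, A \<omega>)) ` \<Omega>') (x, a))"
        using mem by (intro SUP_upper2[of "A \<omega>"]) (auto simp: range_indicator_def)
    qed
  qed
  have "(SUP a\<in>{0..a_max P}. ereal a + range_indicator (A ` \<Omega>') a) = (SUP \<omega>\<in>\<Omega>'. ereal (A \<omega>))"
  proof (rule antisym)
    show "(SUP a\<in>{0..a_max P}. ereal a + range_indicator (A ` \<Omega>') a) \<le> (SUP \<omega>\<in>\<Omega>'. ereal (A \<omega>))"
      by (intro SUP_least) (auto simp: range_indicator_def intro: SUP_upper)
    show "(SUP \<omega>\<in>\<Omega>'. ereal (A \<omega>)) \<le> (SUP a\<in>{0..a_max P}. ereal a + range_indicator (A ` \<Omega>') a)"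
    proof (rule SUP_least)
      fix \<omega> assume "\<omega> \<in> \<Omega>'"
      then show "ereal (A \<omega>) \<le> (SUP a\<in>{0..a_max P}. ereal a + range_indicator (A ` \<Omega>') a)"
        using mem by (intro SUP_upper2[of "A \<omega>"]) (auto simp: range_indicator_def)
    qed
  qed
  also have "\<dots> = ereal (Sup (A ` \<Omega>'))"
  proof (rule ereal_SUP[symmetric])
    obtain \<omega> where "\<omega> \<in> \<Omega>'" using assms(2) by blast
    then have "ereal 0 \<le> (SUP \<omega>\<in>\<Omega>'. ereal (A \<omega>))"
      using mem by (intro SUP_upper2[of \<omega>]) auto
    moreover have "(SUP \<omega>\<in>\<Omega>'. ereal (A \<omega>)) \<le> ereal (a_max P)"
      using mem by (intro SUP_least) auto
    ultimately show "\<bar>SUP \<omega>\<in>\<Omega>'. ereal (A \<omega>)\<bar> \<noteq> \<infinity>" by auto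
  qed
  finally show ?thesis
    unfolding accrued_dist_def joint
    by (cases "SUP \<omega>\<in>{\<omega>\<in>\<Omega>'. X \<omega> = x}. ereal (A \<omega>)") auto
qed

context
  fixes P :: "('o, 'e::metric_space) system"
  assumes wp: "well_posed P"
begin

lemma accrued_of_feasible:
  assumes "feasible P t m"
  shows "(\<lambda>\<omega>. accrued_cost P (snd m) \<omega> t) ` cond_samples P m \<subseteq> {0..a_max P}"
    and "length (snd m) = t" and "set (snd m) \<subseteq> Actions P"
proof -
  show len: "length (snd m) = t" and sub: "set (snd m) \<subseteq> Actions P"
    using assms unfolding feasible_def memory_space_def
    by (auto dest: nlistsE_length nlistsE_set simp: mem_Times_iff)
  show "(\<lambda>\<omega>. accrued_cost P (snd m) \<omega> t) ` cond_samples P m \<subseteq> {0..a_max P}"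
    using accrued_cost_in[OF wp] len sub by (auto simp: cond_samples_def)
qed

lemma accrued_le_worst_accrued:
  assumes "feasible P t m" "\<omega> \<in> cond_samples P m"
  shows "accrued_cost P (snd m) \<omega> t \<le> worst_accrued P m"
proof -
  have "bdd_above ((\<lambda>\<omega>. accrued_cost P (snd m) \<omega> t) ` cond_samples P m)"
    by (rule bdd_above_mono[OF bdd_above_Icc accrued_of_feasible(1)[OF assms(1)]])
  then show ?thesis
    unfolding worst_accrued_def accrued_of_feasible(2)[OF assms(1)] by (rule cSUP_upper[OF assms(2)])
qed

lemma worst_accrued_approx:
  assumes "feasible P t m" "x < worst_accrued P m"
  obtains \<omega> where "\<omega> \<in> cond_samples P m" "x < accrued_cost P (snd m) \<omega> t"
proof -
  have "bdd_above ((\<lambda>\<omega>. accrued_cost P (snd m) \<omega> t) ` cond_samples P m)"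
    by (rule bdd_above_mono[OF bdd_above_Icc accrued_of_feasible(1)[OF assms(1)]])
  moreover have "cond_samples P m \<noteq> {}" using assms(1) by (simp add: feasible_def)
  ultimately show ?thesis
    using assms(2) that unfolding worst_accrued_def accrued_of_feasible(2)[OF assms(1)]
    by (auto simp: less_cSUP_iff)
qed

lemma feasible_snoc:
  assumes "feasible P t m" "u \<in> Actions P" "\<omega> \<in> cond_samples P m"
  shows "feasible P (Suc t) (memory P (snd m @ [u]) \<omega>)"
  using feasible_memory[OF wp cond_samplesD(1)[OF assms(3)], of "snd m @ [u]"] assms(2)
    accrued_of_feasible(2,3)[OF assms(1)] by simp

end


section \<open>Dynamic programming\<close>

context
  fixes P :: "('o, 'e::metric_space) system"
    and S :: "'s::metric_space set"
    and \<sigma> :: "nat \<Rightarrow> 'e memory \<Rightarrow> 's"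
    and \<rho> :: "real \<Rightarrow> 's \<Rightarrow> 's \<Rightarrow> 'e \<Rightarrow> ereal"
  assumes wp: "well_posed P" and info: "information_state P S \<sigma> \<rho>"
begin

lemma cost_dist: "cost_distribution P S \<rho>"
  using info by (simp add: information_state_def)

lemma state_in: "feasible P t m \<Longrightarrow> \<sigma> t m \<in> S"
  using info by (simp add: information_state_def feasible_def)

lemma scale_in: "discount P ^ t \<in> {0<..1}"
  using c_max_bounds[OF wp] by (simp add: power_le_one)

lemma dp_limit_eq_INF:
  assumes "s \<in> S" "z \<in> {0<..1}"
  shows "ereal (dp_limit P S \<rho> s z) = (INF u\<in>Actions P. dp_objective P S \<rho> (dp_limit P S \<rho>) s z u)"
proof -
  have "\<forall>s\<in>S. \<forall>z\<in>{0<..1}. \<bar>dp_limit P S \<rho> s z\<bar> \<le> a_max P"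
    using dp_limit(2)[OF wp cost_dist] by blast
  from ereal_dp_operator(1)[OF wp cost_dist this assms] show ?thesis
    by (simp add: dp_limit(3)[OF wp cost_dist assms])
qed

lemma worst_accrued_plus_rho:
  assumes "feasible P t m" "u \<in> Actions P" "c \<in> Costs P" "s' \<in> S"
  shows "ereal (worst_accrued P m) + \<rho> c s' (\<sigma> t m) u =
    (SUP \<omega>\<in>{\<omega>\<in>cond_samples P m. cost P (snd m @ [u]) \<omega> t = c \<and>
        \<sigma> (Suc t) (memory P (snd m @ [u]) \<omega>) = s'}. ereal (accrued_cost P (snd m) \<omega> t))"
proof -
  have "\<rho> c s' (\<sigma> t m) u = cost_info_dist P \<sigma> t m u c s'"
    using info assms unfolding information_state_def by metis
  moreover have "cond_samples P m \<noteq> {}" using assms(1) by (simp add: feasible_def)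
  ultimately show ?thesis
    using accrued_dist_eq[OF accrued_of_feasible(1)[OF wp assms(1)],
        where x = "(c, s')" and X = "\<lambda>\<omega>. (cost P (snd m @ [u]) \<omega> t, \<sigma> (Suc t) (memory P (snd m @ [u]) \<omega>))"]
    by (simp add: cost_info_dist_def worst_accrued_def accrued_of_feasible(2)[OF wp assms(1)])
qed

text \<open>The candidate value function \<open>W\<^sub>t\<close>.\<close>

definition dp_value :: "nat \<Rightarrow> 'e memory \<Rightarrow> real" where
  "dp_value t m = worst_accrued P m + discount P ^ t * dp_limit P S \<rho> (\<sigma> t m) (discount P ^ t)"

lemma dp_value_bounds:
  assumes "feasible P t m"
  shows "\<bar>dp_value t m - worst_accrued P m\<bar> \<le> discount P ^ t * a_max P"
  using dp_limit(2)[OF wp cost_dist state_in[OF assms] scale_in[of t]] c_max_bounds(4)[OF wp]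
  by (simp add: dp_value_def abs_mult)

text \<open>
  The fixed point lies below the objective at \<open>u\<close>, so some pair \<open>(c, s')\<close> almost attains
  \<open>\<Lambda>\<^sup>\<infinity>(\<sigma>\<^sub>t(m), \<gamma>\<^sup>t)\<close>. For this pair \<open>\<rho>\<close> is finite, hence there is a sample producing \<open>(c, s')\<close> with accrued
  cost close to \<open>\<alpha>(m) + \<rho>\<close>. Each of the two choices uses half of the tolerance \<open>e\<close>.
\<close>

lemma dp_value_step_exists:
  assumes m: "feasible P t m" and u: "u \<in> Actions P" and e: "0 < e"
  obtains \<omega> where "\<omega> \<in> cond_samples P m"
    "dp_value t m - e < dp_value (Suc t) (memory P (snd m @ [u]) \<omega>)"
proof -
  define z where "z = discount P ^ t"
  define \<Lambda> where "\<Lambda> = dp_limit P S \<rho>"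
  \<comment> \<open>The objective at \<open>t\<close> is on the scale of the cost-to-go, so its tolerance is \<open>\<delta> / z\<close>.\<close>
  define \<delta> where "\<delta> = e / 2"
  have z: "0 < z" "z \<in> {0<..1}" using scale_in[of t] by (auto simp: z_def)
  have \<delta>: "0 < \<delta>" "e = \<delta> + \<delta>" using e by (simp_all add: \<delta>_def)
  have "ereal (\<Lambda> (\<sigma> t m) z) \<le> dp_objective P S \<rho> \<Lambda> (\<sigma> t m) z u"
    unfolding \<Lambda>_def dp_limit_eq_INF[OF state_in[OF m] z(2)] by (rule INF_lower[OF u])
  moreover have "ereal (\<Lambda> (\<sigma> t m) z - \<delta> / z) < ereal (\<Lambda> (\<sigma> t m) z)" using z \<delta> by simp
  ultimately have "ereal (\<Lambda> (\<sigma> t m) z - \<delta> / z) < dp_objective P S \<rho> \<Lambda> (\<sigma> t m) z u"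
    by (rule less_le_trans[rotated])
  then obtain c s' where cs: "c \<in> Costs P" "s' \<in> S"
    and less: "ereal (\<Lambda> (\<sigma> t m) z - \<delta> / z)
      < ereal (c + discount P * \<Lambda> s' (discount P * z)) + \<rho> c s' (\<sigma> t m) u / ereal z"
    unfolding dp_objective_def less_SUP_iff by auto
  have "\<rho> c s' (\<sigma> t m) u \<in> {- \<infinity>} \<union> {ereal (- a_max P)..0}"
    using cost_dist cs u state_in[OF m] by (simp add: cost_distribution_def)
  then obtain r where r: "\<rho> c s' (\<sigma> t m) u = ereal r"
    using less z(1) by (cases "\<rho> c s' (\<sigma> t m) u") auto
  have "\<Lambda> (\<sigma> t m) z - \<delta> / z < c + discount P * \<Lambda> s' (discount P * z) + r / z"
    using less z(1) by (simp add: r)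
  then have "z * (\<Lambda> (\<sigma> t m) z - \<delta> / z) < z * (c + discount P * \<Lambda> s' (discount P * z) + r / z)"
    by (rule mult_strict_left_mono[OF _ z(1)])
  then have gap: "z * \<Lambda> (\<sigma> t m) z - \<delta> < z * c + z * (discount P * \<Lambda> s' (discount P * z)) + r"
    using z(1) by (simp add: distrib_left right_diff_distrib)
  have "ereal (worst_accrued P m + r - \<delta>) < ereal (worst_accrued P m) + \<rho> c s' (\<sigma> t m) u"
    using \<delta> by (simp add: r)
  then obtain \<omega> where \<omega>: "\<omega> \<in> cond_samples P m" "cost P (snd m @ [u]) \<omega> t = c"
      "\<sigma> (Suc t) (memory P (snd m @ [u]) \<omega>) = s'"
    and A: "worst_accrued P m + r - \<delta> < accrued_cost P (snd m) \<omega> t"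
    unfolding worst_accrued_plus_rho[OF m u cs] less_SUP_iff by auto
  have "accrued_cost P (snd m @ [u]) \<omega> (Suc t) \<le> worst_accrued P (memory P (snd m @ [u]) \<omega>)"
    using accrued_le_worst_accrued[OF wp feasible_snoc[OF wp m u \<omega>(1)] memory_in_cond_samples]
      cond_samplesD(1)[OF \<omega>(1)] by simp
  then have "accrued_cost P (snd m) \<omega> t + z * c \<le> worst_accrued P (memory P (snd m @ [u]) \<omega>)"
    using accrued_cost_snoc[of P "snd m" u \<omega>] by (simp add: accrued_of_feasible(2)[OF wp m] \<omega>(2) z_def)
  then have "dp_value t m - e < dp_value (Suc t) (memory P (snd m @ [u]) \<omega>)"
    using A gap \<delta>(2) by (simp add: dp_value_def \<omega>(3) z_def \<Lambda>_def algebra_simps)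
  with \<omega>(1) show ?thesis by (rule that)
qed

text \<open>
  All samples compatible with the new memory share the next information state \<open>s'\<close>, but
  not the cost just incurred; the bound is therefore shown for each of them separately, through its
  own pair \<open>(c, s')\<close>, before the supremum is taken.
\<close>

lemma dp_value_step_minimizer:
  assumes m: "feasible P t m" and u: "u \<in> Actions P"
    and min: "dp_objective P S \<rho> (dp_limit P S \<rho>) (\<sigma> t m) (discount P ^ t) u =
      ereal (dp_limit P S \<rho> (\<sigma> t m) (discount P ^ t))"
    and \<omega>: "\<omega> \<in> cond_samples P m"
  shows "dp_value (Suc t) (memory P (snd m @ [u]) \<omega>) \<le> dp_value t m"
proof -
  define z where "z = discount P ^ t"
  define \<Lambda> where "\<Lambda> = dp_limit P S \<rho>"
  define m' where "m' = memory P (snd m @ [u]) \<omega>"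
  define s' where "s' = \<sigma> (Suc t) m'"
  have z: "0 < z" using scale_in[of t] by (auto simp: z_def)
  note len = accrued_of_feasible(2)[OF wp m]
  have m': "feasible P (Suc t) m'" unfolding m'_def by (rule feasible_snoc[OF wp m u \<omega>])
  have s': "s' \<in> S" unfolding s'_def by (rule state_in[OF m'])
  have "accrued_cost P (snd m') \<omega>' (Suc t) \<le> dp_value t m - z * (discount P * \<Lambda> s' (discount P * z))"
    if \<omega>': "\<omega>' \<in> cond_samples P m'" for \<omega>'
  proof -
    define c where "c = cost P (snd m @ [u]) \<omega>' t"
    have mem': "memory P (snd m @ [u]) \<omega>' = m'"
      using cond_samplesD(2)[OF \<omega>'] by (simp add: m'_def)
    then have "memory P (snd m) \<omega>' = memory P (snd m) \<omega>"
      unfolding m'_def by (rule memory_prefix)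
    then have in_m: "\<omega>' \<in> cond_samples P m"
      using cond_samplesD[OF \<omega>] cond_samplesD(1)[OF \<omega>'] by (simp add: cond_samples_def)
    have c: "c \<in> Costs P" unfolding c_def
      using cost_in[OF wp cond_samplesD(1)[OF \<omega>'], of "snd m @ [u]" t] u len
        accrued_of_feasible(3)[OF wp m] by simp
    have "ereal (accrued_cost P (snd m) \<omega>' t) \<le> ereal (worst_accrued P m) + \<rho> c s' (\<sigma> t m) u"
      unfolding worst_accrued_plus_rho[OF m u c s']
      using in_m mem' by (intro SUP_upper) (simp add: c_def s'_def)
    moreover have "\<rho> c s' (\<sigma> t m) u \<in> {- \<infinity>} \<union> {ereal (- a_max P)..0}"
      using cost_dist c s' u state_in[OF m] by (simp add: cost_distribution_def)
    ultimately obtain r where r: "\<rho> c s' (\<sigma> t m) u = ereal r"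
      and A: "accrued_cost P (snd m) \<omega>' t \<le> worst_accrued P m + r"
      by (cases "\<rho> c s' (\<sigma> t m) u") auto
    have "ereal (c + discount P * \<Lambda> s' (discount P * z)) + \<rho> c s' (\<sigma> t m) u / ereal z
        \<le> dp_objective P S \<rho> \<Lambda> (\<sigma> t m) z u"
      unfolding dp_objective_def using c s' by (intro SUP_upper2[of "(c, s')"]) auto
    also have "\<dots> = ereal (\<Lambda> (\<sigma> t m) z)" using min by (simp add: \<Lambda>_def z_def)
    finally have "c + discount P * \<Lambda> s' (discount P * z) + r / z \<le> \<Lambda> (\<sigma> t m) z"
      using z by (simp add: r)
    then have "z * c + z * (discount P * \<Lambda> s' (discount P * z)) + r \<le> z * \<Lambda> (\<sigma> t m) z"
      using z by (simp add: field_simps)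
    moreover have "accrued_cost P (snd m') \<omega>' (Suc t) = accrued_cost P (snd m) \<omega>' t + z * c"
      using accrued_cost_snoc[of P "snd m" u \<omega>'] by (simp add: m'_def len z_def c_def)
    ultimately show ?thesis using A by (simp add: dp_value_def z_def \<Lambda>_def)
  qed
  moreover have "cond_samples P m' \<noteq> {}" using m' by (simp add: feasible_def)
  ultimately have "worst_accrued P m' \<le> dp_value t m - z * (discount P * \<Lambda> s' (discount P * z))"
    unfolding worst_accrued_def accrued_of_feasible(2)[OF wp m'] by (intro cSUP_least)
  then show ?thesis
    by (simp add: dp_value_def[of "Suc t"] m'_def[symmetric] s'_def[symmetric] z_def \<Lambda>_def algebra_simps)
qed

text \<open>
  The tolerance is halved at each step, so the losses accumulated over \<open>n\<close> steps remain below \<open>e\<close>.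
  A sample chosen at step \<open>n\<close> only has to agree with the memory reached so far; by
  \<open>history_agree\<close> this keeps all earlier steps.
\<close>

lemma dp_value_history_exists:
  assumes g: "g \<in> strategies P" and \<omega>: "\<omega> \<in> Samples P" and e: "0 < e"
  shows "\<exists>\<omega>'\<in>cond_samples P (memory P [] \<omega>). dp_value 0 (memory P [] \<omega>) - e < dp_value n (history P g \<omega>' n)"
  using e
proof (induction n arbitrary: e)
  case 0
  then show ?case using memory_in_cond_samples[OF \<omega>, of "[]"]
    by (intro bexI[of _ \<omega>]) (simp_all add: history_def)
next
  case (Suc n)
  from Suc.IH[of "e / 2"] Suc.prems obtain \<omega>' where \<omega>': "\<omega>' \<in> cond_samples P (memory P [] \<omega>)"
    and less: "dp_value 0 (memory P [] \<omega>) - e / 2 < dp_value n (history P g \<omega>' n)" by auto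
  have fe: "feasible P n (history P g \<omega>' n)"
    by (rule feasible_history[OF wp g cond_samplesD(1)[OF \<omega>']])
  obtain \<omega>'' where \<omega>'': "\<omega>'' \<in> cond_samples P (history P g \<omega>' n)"
    and less': "dp_value n (history P g \<omega>' n) - e / 2
      < dp_value (Suc n) (memory P (snd (history P g \<omega>' n) @ [g n (history P g \<omega>' n)]) \<omega>'')"
    using dp_value_step_exists[OF fe strategy_action_in[OF g fe], of "e / 2"] Suc.prems by auto
  note agree = history_agree[OF \<omega>'']
  have "\<omega>'' \<in> cond_samples P (memory P [] \<omega>)"
    using agree(3) cond_samplesD(2)[OF \<omega>'] by simp
  moreover have "dp_value 0 (memory P [] \<omega>) - e < dp_value (Suc n) (history P g \<omega>'' (Suc n))"
    unfolding history_Suc agree(2) using less less' by simp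
  ultimately show ?case ..
qed

text \<open>
  Three losses of \<open>e / 3\<close>: the drop of the candidate value along the trajectory, the discounted
  cost-to-go still contained in \<open>W\<^sub>n\<close>, and the choice of a sample whose accrued cost nearly attains \<open>\<alpha>\<close>.
\<close>

lemma dp_value_le_total_cost:
  assumes g: "g \<in> strategies P" and \<omega>: "\<omega> \<in> Samples P" and e: "0 < e"
  shows "\<exists>\<omega>'\<in>cond_samples P (memory P [] \<omega>). dp_value 0 (memory P [] \<omega>) - e < total_cost P g \<omega>'"
proof -
  have e3: "0 < e / 3" using e by simp
  obtain n where n: "discount P ^ n * a_max P < e / 3" using discounted_tail_small[OF wp e3] .
  obtain \<omega>' where \<omega>': "\<omega>' \<in> cond_samples P (memory P [] \<omega>)"
    and less: "dp_value 0 (memory P [] \<omega>) - e / 3 < dp_value n (history P g \<omega>' n)"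
    using dp_value_history_exists[OF g \<omega> e3] by blast
  have fe: "feasible P n (history P g \<omega>' n)"
    by (rule feasible_history[OF wp g cond_samplesD(1)[OF \<omega>']])
  obtain \<omega>'' where \<omega>'': "\<omega>'' \<in> cond_samples P (history P g \<omega>' n)"
    and A: "worst_accrued P (history P g \<omega>' n) - e / 3 < accrued_cost P (snd (history P g \<omega>' n)) \<omega>'' n"
    using worst_accrued_approx[OF wp fe] e3 by (metis diff_less_eq less_add_same_cancel1)
  note agree = history_agree[OF \<omega>'']
  have "accrued_cost P (snd (history P g \<omega>' n)) \<omega>'' n \<le> total_cost P g \<omega>''"
    using total_cost_bounds(1)[OF wp g cond_samplesD(1)[OF \<omega>''], of n] agree(1) by simp
  then have "dp_value 0 (memory P [] \<omega>) - e < total_cost P g \<omega>''"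
    using n less A dp_value_bounds[OF fe] by (simp add: abs_le_iff)
  moreover have "\<omega>'' \<in> cond_samples P (memory P [] \<omega>)"
    using agree(3) cond_samplesD(2)[OF \<omega>'] by simp
  ultimately show ?thesis ..
qed

text \<open>
  Here the tail \<open>\<gamma>\<^sup>n a\<^sup>m\<^sup>a\<^sup>x\<close> is paid twice, once for the costs after time \<open>n\<close> and once for replacing
  \<open>\<alpha>\<close> by \<open>W\<^sub>n\<close>.
\<close>

lemma total_cost_le_dp_value:
  assumes g: "g \<in> strategies P" and \<omega>: "\<omega> \<in> Samples P"
    and min: "\<And>t m. feasible P t m \<Longrightarrow>
      dp_objective P S \<rho> (dp_limit P S \<rho>) (\<sigma> t m) (discount P ^ t) (g t m) =
      ereal (dp_limit P S \<rho> (\<sigma> t m) (discount P ^ t))"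
  shows "total_cost P g \<omega> \<le> dp_value 0 (memory P [] \<omega>)"
proof (rule field_le_epsilon)
  fix e :: real assume e: "0 < e"
  obtain n where n: "discount P ^ n * a_max P < e / 2" using discounted_tail_small[OF wp, of "e / 2"] e by auto
  have fe: "feasible P n (history P g \<omega> n)" for n by (rule feasible_history[OF wp g \<omega>])
  have in_h: "\<omega> \<in> cond_samples P (history P g \<omega> n)" for n
    unfolding history_def by (rule memory_in_cond_samples[OF \<omega>])
  have chain: "dp_value n (history P g \<omega> n) \<le> dp_value 0 (memory P [] \<omega>)" for n
  proof (induction n)
    case (Suc n)
    with dp_value_step_minimizer[OF fe strategy_action_in[OF g fe] min[OF fe] in_h, of n] show ?case
      by (simp add: history_Suc)
  qed (simp add: history_def)
  have "total_cost P g \<omega>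
      \<le> accrued_cost P (snd (history P g \<omega> n)) \<omega> n + discount P ^ n * a_max P"
    using total_cost_bounds(2)[OF wp g \<omega>] by simp
  then show "total_cost P g \<omega> \<le> dp_value 0 (memory P [] \<omega>) + e"
    using accrued_le_worst_accrued[OF wp fe in_h, of n] dp_value_bounds[OF fe, of n] chain[of n] n
    by (simp add: abs_le_iff)
qed

text \<open>
  The supremum is restricted to the samples with the same first observation, which serves the
  value at \<open>y\<^sub>0\<close>; the comparison of worst-case costs follows by enlarging it to all samples.
\<close>

lemma minimizing_strategy_optimal:
  assumes g: "g \<in> strategies P" and g': "g' \<in> strategies P" and \<omega>: "\<omega> \<in> Samples P"
    and min: "\<And>t m. feasible P t m \<Longrightarrow>
      dp_objective P S \<rho> (dp_limit P S \<rho>) (\<sigma> t m) (discount P ^ t) (g t m) =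
      ereal (dp_limit P S \<rho> (\<sigma> t m) (discount P ^ t))"
  shows "ereal (total_cost P g \<omega>)
    \<le> (SUP \<omega>'\<in>cond_samples P (memory P [] \<omega>). ereal (total_cost P g' \<omega>'))"
proof (rule ereal_le_epsilon2)
  fix e :: real assume "0 < e"
  from dp_value_le_total_cost[OF g' \<omega> this] obtain \<omega>' where
    \<omega>': "\<omega>' \<in> cond_samples P (memory P [] \<omega>)"
    and less: "dp_value 0 (memory P [] \<omega>) - e < total_cost P g' \<omega>'" ..
  have "ereal (total_cost P g \<omega>) \<le> ereal (total_cost P g' \<omega>') + ereal e"
    using less total_cost_le_dp_value[OF g \<omega> min] by simp
  also have "\<dots> \<le> (SUP \<omega>'\<in>cond_samples P (memory P [] \<omega>). ereal (total_cost P g' \<omega>')) + ereal e"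
    by (intro add_right_mono SUP_upper \<omega>')
  finally show "ereal (total_cost P g \<omega>) \<le> \<dots>" .
qed

end


section \<open>Optimality of the information-state strategy\<close>

theorem mainTheorem2:
  fixes P :: "('o, 'e::metric_space) system"
    and S :: "'s::metric_space set"
    and \<sigma> :: "nat \<Rightarrow> 'e memory \<Rightarrow> 's"
    and \<rho> :: "real \<Rightarrow> 's \<Rightarrow> 's \<Rightarrow> 'e \<Rightarrow> ereal"
    and \<pi> :: "'s \<Rightarrow> real \<Rightarrow> 'e"
    and g_opt :: "'e strategy"
  assumes "well_posed P"
    and "information_state P S \<sigma> \<rho>"
    and "\<And>n. infimum_achieved P S \<rho> (dp_iterate P S \<rho> n)"
    and "infimum_achieved P S \<rho> (dp_limit P S \<rho>)"
    and "\<And>s z. s \<in> S \<Longrightarrow> z \<in> {0<..1} \<Longrightarrow>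
           is_arg_min (dp_objective P S \<rho> (dp_limit P S \<rho>) s z) (\<lambda>u. u \<in> Actions P) (\<pi> s z)"
    and "\<And>t m. m \<in> memory_space P t \<Longrightarrow> g_opt t m = \<pi> (\<sigma> t m) (discount P ^ t)"
  shows "(\<forall>y. feasible P 0 ([y], []) \<longrightarrow>
            strategy_value P 0 g_opt ([y], []) = optimal_value P 0 ([y], [])) \<and>
         g_opt \<in> strategies P \<and>
         worst_case_cost P g_opt = (INF g\<in>strategies P. worst_case_cost P g)"
proof -
  note wp = assms(1) and info = assms(2)
  let ?\<Lambda> = "dp_limit P S \<rho>"
  have \<sigma>: "\<sigma> t m \<in> S" if "m \<in> memory_space P t" for t m
    using info that by (simp add: information_state_def)
  have argmin: "is_arg_min (dp_objective P S \<rho> ?\<Lambda> (\<sigma> t m) (discount P ^ t)) (\<lambda>u. u \<in> Actions P) (g_opt t m)"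
    if "m \<in> memory_space P t" for t m
    unfolding assms(6)[OF that] by (rule assms(5)[OF \<sigma>[OF that] scale_in[OF wp info]])
  have g: "g_opt \<in> strategies P"
    using argmin by (simp add: strategies_def is_arg_min_def)
  have min: "dp_objective P S \<rho> ?\<Lambda> (\<sigma> t m) (discount P ^ t) (g_opt t m) = ereal (?\<Lambda> (\<sigma> t m) (discount P ^ t))"
    if "feasible P t m" for t m
  proof -
    have m: "m \<in> memory_space P t" using that by (simp add: feasible_def)
    show ?thesis
      unfolding dp_limit_eq_INF[OF wp info \<sigma>[OF m] scale_in[OF wp info]]
      using argmin[OF m] by (intro antisym INF_greatest INF_lower) (auto simp: is_arg_min_def not_less)
  qed
  note opt = minimizing_strategy_optimal[OF wp info g _ _ min]
  have "strategy_value P 0 g_opt ([y], []) = optimal_value P 0 ([y], [])" for y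
  proof (rule antisym)
    have "strategy_value P 0 g_opt ([y], []) \<le> strategy_value P 0 g ([y], [])"
      if "g \<in> strategies P" for g
      unfolding strategy_value_eq
    proof (rule SUP_least)
      fix \<omega> assume "\<omega> \<in> cond_samples P ([y], [])"
      then show "ereal (total_cost P g_opt \<omega>)
          \<le> (SUP \<omega>\<in>cond_samples P ([y], []). ereal (total_cost P g \<omega>))"
        using opt[OF that cond_samplesD(1)] cond_samplesD(2) by fastforce
    qed
    then show "strategy_value P 0 g_opt ([y], []) \<le> optimal_value P 0 ([y], [])"
      unfolding optimal_value_def by (rule INF_greatest)
    show "optimal_value P 0 ([y], []) \<le> strategy_value P 0 g_opt ([y], [])"
      unfolding optimal_value_def by (rule INF_lower[OF g])
  qed
  moreover have "worst_case_cost P g_opt = (INF g\<in>strategies P. worst_case_cost P g)"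
  proof (intro antisym INF_greatest INF_lower g)
    fix g assume g': "g \<in> strategies P"
    show "worst_case_cost P g_opt \<le> worst_case_cost P g"
      unfolding worst_case_cost_eq[OF wp g] worst_case_cost_eq[OF wp g']
    proof (rule SUP_least)
      fix \<omega> assume "\<omega> \<in> Samples P"
      from opt[OF g' this] show "ereal (total_cost P g_opt \<omega>)
          \<le> (SUP \<omega>\<in>Samples P. ereal (total_cost P g \<omega>))"
        by (rule order_trans) (auto intro!: SUP_subset_mono dest: cond_samplesD(1))
    qed
  qed
  ultimately show ?thesis using g by blast
qed

end
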